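(* Let $f_1,\dots,f_m$ be rational linear forms on $\mathbb{R}^d$ of constant positive weight ($f_1(\mathbf 1)=\cdots=f_m(\mathbf 1)>0$, $\mathbf 1=(1,\dots,1)$), such that every variable appears in at least one form and $f_1(x)=\cdots=f_m(x)=1$ is consistent; let $s$ be its solution space, $\mathcal O:=\mathbb{R}^d_{\ge0}$, $P:=s\cap\mathcal O$, and $\mathcal{H}:=\{h_{jk}\cap s : h_{jk}\not\supseteq s\}$ where $h_{jk}$ is the hyperplane $x_j=x_k$. Assume a magic labelling exists, i.e. an integer point $x$ with distinct positive coordinates and $f_1(x)=\cdots=f_m(x)$. Let $A^\circ(t)$ be the number of integer points of $tP$ with distinct positive entries and $A(t)$ the number of pairs $(x,\sigma)$ with $x$ a nonnegative integer point of $tP$ and $\sigma$ a permutation of $[d]$ compatible with $x$ and realizable in $P^\circ$. Then $$A^\circ(t)=\sum_{u\in\mathcal{L}(P^\circ,\mathcal{H})}\mu(\hat0,u)\,E_{u\cap\mathcal O^\circ}(t),\qquad A(t)=\sum_{u\in\mathcal{L}(P^\circ,\mathcal{H})}|\mu(\hat0,u)|\,E_{u\cap\mathcal O}(t),$$ where $\mu$ is the Möbius function of $\mathcal{L}(P^\circ,\mathcal{H})$.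
   Context: $\mathcal O^\circ$ is the open positive orthant and $P^\circ$ the relative interior of $P$. $\mathcal{L}(P^\circ,\mathcal{H}) := \{P^\circ\cap\bigcap\mathcal S:\mathcal S\subseteq\mathcal H\}\setminus\{\emptyset\}$ ordered by reverse inclusion, with bottom $\hat0=P^\circ$. For a member $u$, $E_{Q\cap u}(t)$ is the number of integer points in $t(Q\cap\bar u)$, where $\bar u=\bigcap\mathcal S\subseteq s$ is the flat whose intersection with $P^\circ$ is $u$. Möbius function: $\mu(r,r)=1$, $\mu(r,s)=-\sum_{r\le w<s}\mu(r,w)$ for $r<s$. A point realizes permutation $\tau$ if $x_{\tau1}<\cdots<x_{\tau d}$; compatible means $x_{\sigma1}\le\cdots\le x_{\sigma d}$.
   Formalization: Forms with coefficients of mixed sign can make P unbounded and the counts infinite (e.g. x1+x2−x3 gives ∞−∞), so each formula is asserted for those positive integers t at which tP (for A), or its part in the open orthant (for A°), has finitely many integer points. *)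

theory Defs
  imports "HOL-Analysis.Analysis"
begin

text \<open>Coordinates are indexed by a finite type \<open>'n\<close>, which plays the role of
  \<open>[d]\<close> with \<open>d = CARD('n)\<close>; a linear order on it is needed only for permutations.\<close>

definition rational_linear_form :: "(real^'n \<Rightarrow> real) \<Rightarrow> bool" where
  "rational_linear_form g \<longleftrightarrow> linear g \<and> (\<forall>j. g (axis j 1) \<in> \<rat>)"

definition appears_in :: "'n \<Rightarrow> (real^'n \<Rightarrow> real) \<Rightarrow> bool" where
  "appears_in j g \<longleftrightarrow> g (axis j 1) \<noteq> 0"

definition solution_space :: "nat \<Rightarrow> (nat \<Rightarrow> real^'n \<Rightarrow> real) \<Rightarrow> (real^'n) set" where
  "solution_space m f = {x. \<forall>i\<in>{1..m}. f i x = 1}"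

definition orthant :: "(real^'n) set" where
  "orthant = {x. \<forall>j. 0 \<le> x $ j}"

definition open_orthant :: "(real^'n) set" where
  "open_orthant = {x. \<forall>j. 0 < x $ j}"

definition magic_polytope :: "nat \<Rightarrow> (nat \<Rightarrow> real^'n \<Rightarrow> real) \<Rightarrow> (real^'n) set" where
  "magic_polytope m f = solution_space m f \<inter> orthant"

definition hyperplane_eq :: "'n \<Rightarrow> 'n \<Rightarrow> (real^'n) set" where
  "hyperplane_eq j k = {x. x $ j = x $ k}"

definition induced_arrangement :: "(real^'n) set \<Rightarrow> (real^'n) set set" where
  "induced_arrangement s =
     {hyperplane_eq j k \<inter> s | j k. j \<noteq> k \<and> \<not> s \<subseteq> hyperplane_eq j k}"

text \<open>The intersection over the empty subfamily is \<open>UNIV\<close>, so the region \<open>R\<close> itself is a member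
  whenever it is nonempty.\<close>

definition intersection_poset :: "'a set \<Rightarrow> 'a set set \<Rightarrow> 'a set set" where
  "intersection_poset R \<H> = {R \<inter> \<Inter>\<S> | \<S>. \<S> \<subseteq> \<H>} - {{}}"

text \<open>Moebius function of a finite family \<open>L\<close> of sets ordered by reverse inclusion, so that
  \<open>r \<le> w < v\<close> reads \<open>v \<subset> w \<and> w \<subseteq> r\<close>.  The value is 0 outside the intended domain.\<close>

function mobius :: "'a set set \<Rightarrow> 'a set \<Rightarrow> 'a set \<Rightarrow> int" where
  "mobius L r v =
     (if finite L \<and> r \<in> L \<and> v \<in> L then
        if v = r then 1
        else if v \<subset> r then - (\<Sum>w\<in>{w\<in>L. v \<subset> w \<and> w \<subseteq> r}. mobius L r w)
        else 0
      else 0)"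
  by auto
termination
proof (relation "Wellfounded.measure (\<lambda>(L, r, v). card {w\<in>L. v \<subset> w \<and> w \<subseteq> r})", goal_cases)
  case 1
  show ?case by simp
next
  case (2 L r v w)
  then have "{x\<in>L. w \<subset> x \<and> x \<subseteq> r} \<subset> {x\<in>L. v \<subset> x \<and> x \<subseteq> r}"
    by blast
  with 2 show ?case
    by (auto intro!: psubset_card_mono)
qed

declare mobius.simps [simp del]

text \<open>The flat \<open>F\<close> of the arrangement \<open>\<H>\<close> in \<open>s\<close> that cuts out the member \<open>u\<close> of
  \<open>intersection_poset R \<H>\<close>.  The empty subfamily yields \<open>s\<close>.  When \<open>R\<close> is open relative to \<open>s\<close>
  the flat is unique, being the affine hull of \<open>u\<close>.\<close>

definition flat_of ::
    "(real^'n) set \<Rightarrow> (real^'n) set \<Rightarrow> (real^'n) set set \<Rightarrow> (real^'n) set \<Rightarrow> (real^'n) set" where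
  "flat_of s R \<H> u = (THE F. \<exists>\<S>\<subseteq>\<H>. F = s \<inter> \<Inter>\<S> \<and> R \<inter> F = u)"

definition integer_points :: "(real^'n) set \<Rightarrow> (real^'n) set" where
  "integer_points X = {x\<in>X. \<forall>j. x $ j \<in> \<int>}"

definition dilate :: "nat \<Rightarrow> (real^'n) set \<Rightarrow> (real^'n) set" where
  "dilate t X = (\<lambda>x. real t *\<^sub>R x) ` X"

definition ehrhart :: "(real^'n) set \<Rightarrow> nat \<Rightarrow> nat" where
  "ehrhart X t = card (integer_points (dilate t X))"

definition distinct_entries :: "real^'n \<Rightarrow> bool" where
  "distinct_entries x \<longleftrightarrow> inj (\<lambda>j. x $ j)"

definition magic_labelling :: "nat \<Rightarrow> (nat \<Rightarrow> real^'n \<Rightarrow> real) \<Rightarrow> real^'n \<Rightarrow> bool" where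
  "magic_labelling m f x \<longleftrightarrow>
     (\<forall>j. x $ j \<in> \<int>) \<and> distinct_entries x \<and> (\<forall>j. 0 < x $ j) \<and>
     (\<forall>i\<in>{1..m}. \<forall>k\<in>{1..m}. f i x = f k x)"

definition realizes :: "real^'n::{finite,linorder} \<Rightarrow> ('n \<Rightarrow> 'n) \<Rightarrow> bool" where
  "realizes x \<tau> \<longleftrightarrow> strict_mono (\<lambda>i. x $ \<tau> i)"

definition compatible :: "real^'n::{finite,linorder} \<Rightarrow> ('n \<Rightarrow> 'n) \<Rightarrow> bool" where
  "compatible x \<sigma> \<longleftrightarrow> mono (\<lambda>i. x $ \<sigma> i)"

definition realizable_in :: "(real^'n::{finite,linorder}) set \<Rightarrow> ('n \<Rightarrow> 'n) \<Rightarrow> bool" where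
  "realizable_in R \<tau> \<longleftrightarrow> (\<exists>y\<in>R. realizes y \<tau>)"

definition strict_magic_count :: "nat \<Rightarrow> (nat \<Rightarrow> real^'n \<Rightarrow> real) \<Rightarrow> nat \<Rightarrow> nat" where
  "strict_magic_count m f t =
     card {x \<in> integer_points (dilate t (magic_polytope m f)).
             distinct_entries x \<and> (\<forall>j. 0 < x $ j)}"

definition weak_magic_count ::
    "nat \<Rightarrow> (nat \<Rightarrow> real^'n::{finite,linorder} \<Rightarrow> real) \<Rightarrow> nat \<Rightarrow> nat" where
  "weak_magic_count m f t =
     card {(x, \<sigma>). x \<in> integer_points (dilate t (magic_polytope m f)) \<and> (\<forall>j. 0 \<le> x $ j) \<and>
                   \<sigma> permutes UNIV \<and> compatible x \<sigma> \<and>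
                   realizable_in (rel_interior (magic_polytope m f)) \<sigma>}"

text \<open>Coefficients of mixed sign can make \<open>magic_polytope m f\<close> unbounded, and then the counts above
  may be infinite.  Nonnegative coefficients rule this out, because every variable appears.\<close>

lemma finite_integer_points_dilate:
  fixes X :: "(real^'n) set"
  assumes "bounded X"
  shows "finite (integer_points (dilate t X))"
proof -
  have "bounded (dilate t X)"
    unfolding dilate_def using assms by (rule bounded_scaling)
  then obtain B where B: "\<And>x. x \<in> dilate t X \<Longrightarrow> norm x \<le> B"
    unfolding bounded_iff by blast
  let ?C = "{k::real. k \<in> \<int> \<and> \<bar>k\<bar> \<le> B}"
  have "finite (PiE (UNIV::'n set) (\<lambda>_. ?C))"
    by (intro finite_PiE finite_abs_int_segment) auto
  moreover have "(\<lambda>x j. x $ j) ` integer_points (dilate t X) \<subseteq> PiE UNIV (\<lambda>_. ?C)"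
    unfolding integer_points_def using B component_le_norm_cart order_trans by fastforce
  ultimately have "finite ((\<lambda>x j. x $ j) ` integer_points (dilate t X))"
    using finite_subset by blast
  moreover have "inj_on (\<lambda>x j. x $ j) (integer_points (dilate t X))"
    by (auto simp: inj_on_def vec_eq_iff fun_eq_iff)
  ultimately show ?thesis
    by (rule finite_imageD)
qed

lemma bounded_magic_polytope:
  fixes f :: "nat \<Rightarrow> real^'n \<Rightarrow> real"
  assumes lin: "\<And>i. i \<in> {1..m} \<Longrightarrow> rational_linear_form (f i)"
    and nonneg: "\<And>i j. i \<in> {1..m} \<Longrightarrow> 0 \<le> f i (axis j 1)"
    and cover: "\<And>j. \<exists>i\<in>{1..m}. appears_in j (f i)"
  shows "bounded (magic_polytope m f)"
proof -
  have *: "\<exists>b. \<forall>x\<in>magic_polytope m f. \<bar>x $ j\<bar> \<le> b" for j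
  proof -
    obtain i where i: "i \<in> {1..m}" "f i (axis j 1) \<noteq> 0"
      using cover unfolding appears_in_def by blast
    with nonneg have pos: "0 < f i (axis j 1)"
      by (metis order_le_less)
    have "\<bar>x $ j\<bar> \<le> 1 / f i (axis j 1)" if x: "x \<in> magic_polytope m f" for x
    proof -
      have x0: "\<And>k. 0 \<le> x $ k" and x1: "f i x = 1"
        using x i unfolding magic_polytope_def orthant_def solution_space_def by auto
      have l: "linear (f i)"
        using lin i unfolding rational_linear_form_def by blast
      have "f i x = f i (\<Sum>k\<in>UNIV. x $ k *\<^sub>R axis k 1)"
        using basis_expansion[of x] by (simp add: scalar_mult_eq_scaleR)
      also have "\<dots> = (\<Sum>k\<in>UNIV. x $ k * f i (axis k 1))"
        using l by (simp add: linear_sum linear_cmul)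
      finally have "(\<Sum>k\<in>UNIV. x $ k * f i (axis k 1)) = 1"
        using x1 by simp
      moreover have "x $ j * f i (axis j 1) \<le> (\<Sum>k\<in>UNIV. x $ k * f i (axis k 1))"
        using x0 nonneg i by (intro member_le_sum) auto
      ultimately show ?thesis
        using pos x0[of j] by (simp add: field_simps)
    qed
    then show ?thesis by blast
  qed
  then obtain b where b: "\<And>j x. x \<in> magic_polytope m f \<Longrightarrow> \<bar>x $ j\<bar> \<le> b j"
    by metis
  have "norm x \<le> (\<Sum>j\<in>UNIV. b j)" if "x \<in> magic_polytope m f" for x
    using norm_le_l1_cart[of x] b[OF that] by (meson order_trans sum_mono)
  then show ?thesis
    unfolding bounded_iff by blast
qed

end

theory Submission
  imports Defs
begin

text \<open>A constant vector lies in the solution space and on every hyperplane \<open>x\<^sub>j = x\<^sub>k\<close>, and the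
  magic labelling, shifted along the diagonal, shows that no such hyperplane contains the solution
  space.  Hence the poset is the lattice of flats of a central arrangement, and \<open>\<mu>(0,u)\<close> is the sum
  of \<open>(-1)\<^bsup>|S|\<^esup>\<close> over the sets \<open>S\<close> of hyperplanes cutting out \<open>u\<close>.  Exchanging summations
  reduces both formulas to a statement about a single point \<open>x\<close> and the set of hyperplanes
  through it.  The first becomes the vanishing of the alternating sum over the subsets of a
  nonempty set.  The second becomes Zaslavsky's theorem: the number of regions of a central
  arrangement is the sum of \<open>(-1)\<^bsup>|S| + codim S\<^esup>\<close> over all sets \<open>S\<close> of hyperplanes.  Any sum with
  these signs whose terms are weighted by a function of the flat obeys deletion-restriction.  With
  weight 1 it therefore counts regions, and with the indicator function of a single flat as weight
  it is nonnegative, hence equal to \<open>|\<mu>|\<close> at that flat.\<close>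

section \<open>Moebius values of intersection posets\<close>

lemma sum_Pow_insert:
  fixes g :: "'i set \<Rightarrow> 'b::comm_monoid_add"
  assumes "finite I" and "k \<notin> I"
  shows "sum g (Pow (insert k I)) = sum g (Pow I) + (\<Sum>S\<in>Pow I. g (insert k S))"
proof -
  have "inj_on (insert k) (Pow I)"
    using assms(2) by (auto simp: inj_on_def)
  moreover have "Pow I \<inter> insert k ` Pow I = {}"
    using assms(2) by auto
  ultimately show ?thesis
    using assms(1) by (simp add: Pow_insert sum.union_disjoint sum.reindex)
qed

lemma sum_Pow_minus_one_power_card:
  assumes "finite I"
  shows "(\<Sum>S\<in>Pow I. (-1) ^ card S) = (if I = {} then 1 else 0 :: 'a::comm_ring_1)"
  using prod_diff_conv_sum[OF assms, of "\<lambda>_. 1" "\<lambda>_. 1 :: 'a"] assms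
  by (simp add: power_0_left)

lemma mobius_eqI:
  fixes \<nu> :: "'a set \<Rightarrow> int"
  assumes poset: "finite L" "R \<in> L"
    and sum_above: "\<And>v. v \<in> L \<Longrightarrow> v \<subseteq> R \<Longrightarrow>
      (\<Sum>w | w \<in> L \<and> v \<subseteq> w \<and> w \<subseteq> R. \<nu> w) = (if v = R then 1 else 0)"
    and "v \<in> L" and "v \<subseteq> R"
  shows "mobius L R v = \<nu> v"
  using \<open>v \<in> L\<close> \<open>v \<subseteq> R\<close>
proof (induction "card {w \<in> L. v \<subset> w \<and> w \<subseteq> R}" arbitrary: v rule: less_induct)
  case less
  let ?above = "{w \<in> L. v \<subset> w \<and> w \<subseteq> R}"
  have "{w \<in> L. v \<subseteq> w \<and> w \<subseteq> R} = insert v ?above"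
    using less.prems by auto
  then have recursion: "\<nu> v + sum \<nu> ?above = (if v = R then 1 else 0)"
    using sum_above[OF less.prems] poset(1) by simp
  have "mobius L R w = \<nu> w" if "w \<in> ?above" for w
  proof (rule less.hyps)
    show "card {x \<in> L. w \<subset> x \<and> x \<subseteq> R} < card ?above"
      using poset(1) that by (intro psubset_card_mono) auto
  qed (use that in auto)
  then have "mobius L R v = (if v = R then 1 else - sum \<nu> ?above)"
    using poset less.prems by (subst mobius.simps) auto
  moreover have "sum \<nu> ?above = 0" if "v = R"
    using that by (intro sum.neutral) auto
  ultimately show ?case
    using recursion by (simp split: if_splits)
qed

lemma intersection_poset_image:
  "intersection_poset R (H ` I) = (\<lambda>S. R \<inter> \<Inter>(H ` S)) ` Pow I - {{}}"
  unfolding intersection_poset_def by (auto simp: subset_image_iff)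

text \<open>The subfamilies whose intersection contains \<open>v\<close> form a Boolean lattice, so their alternating
  sums satisfy the recursion of the Moebius function.\<close>

lemma sum_alternating_above:
  fixes H :: "'i \<Rightarrow> 'a set"
  assumes finite: "finite I" and proper: "\<And>i. i \<in> I \<Longrightarrow> \<not> R \<subseteq> H i"
    and member: "v \<in> intersection_poset R (H ` I)"
  shows "(\<Sum>w | w \<in> intersection_poset R (H ` I) \<and> v \<subseteq> w \<and> w \<subseteq> R.
      \<Sum>S | S \<subseteq> I \<and> R \<inter> \<Inter>(H ` S) = w. (-1) ^ card S) = (if v = R then 1 else 0 :: int)"
proof -
  define Z where "Z S = R \<inter> \<Inter>(H ` S)" for S
  define J where "J = {i \<in> I. v \<subseteq> H i}"
  let ?W = "{w. w \<in> intersection_poset R (H ` I) \<and> v \<subseteq> w \<and> w \<subseteq> R}"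
  have poset: "intersection_poset R (H ` I) = Z ` Pow I - {{}}"
    by (simp add: intersection_poset_image Z_def)
  obtain S where cut_out: "S \<subseteq> I" "v = Z S" "v \<noteq> {}"
    using member poset by blast
  have "(\<Sum>w\<in>?W. \<Sum>S | S \<subseteq> I \<and> Z S = w. (-1) ^ card S) =
      (\<Sum>w\<in>?W. \<Sum>S | S \<in> Pow J \<and> Z S = w. (-1) ^ card S :: int)"
    by (intro sum.cong refl arg_cong2[of _ _ _ _ sum]) (auto simp: J_def Z_def)
  also have "\<dots> = (\<Sum>S\<in>Pow J. (-1) ^ card S)"
  proof (rule sum.group)
    have "Z T \<in> ?W" if "T \<subseteq> J" for T
    proof -
      have "T \<subseteq> I"
        using that by (auto simp: J_def)
      moreover have "v \<subseteq> Z T" "Z T \<subseteq> R"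
        using that cut_out(2) by (auto simp: J_def Z_def)
      moreover have "Z T \<noteq> {}"
        using \<open>v \<subseteq> Z T\<close> cut_out(3) by blast
      ultimately show ?thesis
        unfolding poset by blast
    qed
    then show "Z ` Pow J \<subseteq> ?W"
      by blast
  qed (use finite in \<open>simp_all add: J_def poset\<close>)
  also have "\<dots> = (if J = {} then 1 else 0)"
    using finite by (intro sum_Pow_minus_one_power_card) (simp add: J_def)
  also have "J = {} \<longleftrightarrow> v = R"
  proof
    assume "J = {}"
    moreover have "S \<subseteq> J"
      using cut_out by (auto simp: J_def Z_def)
    ultimately show "v = R"
      using cut_out(2) by (simp add: Z_def)
  qed (use proper in \<open>auto simp: J_def\<close>)
  finally show ?thesis
    unfolding Z_def .
qed

lemma mobius_intersection_poset:
  fixes H :: "'i \<Rightarrow> 'a set"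
  assumes "finite I" and "\<And>i. i \<in> I \<Longrightarrow> \<not> R \<subseteq> H i"
    and member: "u \<in> intersection_poset R (H ` I)"
  shows "mobius (intersection_poset R (H ` I)) R u =
    (\<Sum>S | S \<subseteq> I \<and> R \<inter> \<Inter>(H ` S) = u. (-1) ^ card S)"
proof (rule mobius_eqI)
  show "finite (intersection_poset R (H ` I))"
    using assms(1) by (simp add: intersection_poset_def)
  show "u \<subseteq> R"
    using member by (auto simp: intersection_poset_def)
  then show "R \<in> intersection_poset R (H ` I)"
    using member by (auto simp: intersection_poset_def intro: exI[of _ "{}"])
  show "(\<Sum>w | w \<in> intersection_poset R (H ` I) \<and> v \<subseteq> w \<and> w \<subseteq> R.
      \<Sum>S | S \<subseteq> I \<and> R \<inter> \<Inter>(H ` S) = w. (-1) ^ card S) = (if v = R then 1 else 0 :: int)"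
    if "v \<in> intersection_poset R (H ` I)" for v
    using assms(1,2) that by (rule sum_alternating_above)
qed (rule member)


section \<open>Regions of a central arrangement\<close>

lemma eventually_sgn_add_mult:
  fixes c d :: real
  shows "\<forall>\<^sub>F e in at_right 0. sgn (c + e * d) = (if c = 0 then sgn d else sgn c)"
proof -
  have "((\<lambda>e. c + e * d) \<longlongrightarrow> c + 0 * d) (at_right 0)"
    by (intro tendsto_intros)
  then have lim: "((\<lambda>e. c + e * d) \<longlongrightarrow> c) (at_right 0)"
    by simp
  show ?thesis
  proof (cases c "0 :: real" rule: linorder_cases)
    case less
    with order_tendstoD(2)[OF lim less] show ?thesis
      by (auto elim: eventually_mono)
  next
    case equal
    show ?thesis
      using eventually_at_right_less[of "0 :: real"]
      by (rule eventually_mono) (simp add: equal sgn_mult)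
  next
    case greater
    with order_tendstoD(1)[OF lim greater] show ?thesis
      by (auto elim: eventually_mono)
  qed
qed

lemma sgn_linear_perturbation:
  fixes a :: "'i \<Rightarrow> 'a::real_normed_vector \<Rightarrow> real"
  assumes "finite I" and linear: "\<And>i. i \<in> I \<Longrightarrow> linear (a i)" and neighbourhood: "open U" "x \<in> U"
  obtains e where "x + e *\<^sub>R v \<in> U"
    and "\<And>i. i \<in> I \<Longrightarrow> sgn (a i (x + e *\<^sub>R v)) = (if a i x = 0 then sgn (a i v) else sgn (a i x))"
proof -
  have "((\<lambda>e. x + e *\<^sub>R v) \<longlongrightarrow> x + 0 *\<^sub>R v) (at_right 0)"
    by (intro tendsto_intros)
  then have "\<forall>\<^sub>F e in at_right 0. x + e *\<^sub>R v \<in> U"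
    using neighbourhood by (auto intro: topological_tendstoD)
  moreover have "\<forall>\<^sub>F e in at_right 0. sgn (a i (x + e *\<^sub>R v)) =
      (if a i x = 0 then sgn (a i v) else sgn (a i x))" if "i \<in> I" for i
    using eventually_sgn_add_mult linear[OF that] by (simp add: linear_add linear_cmul)
  ultimately have "\<forall>\<^sub>F e in at_right 0. x + e *\<^sub>R v \<in> U \<and> (\<forall>i\<in>I. sgn (a i (x + e *\<^sub>R v)) =
      (if a i x = 0 then sgn (a i v) else sgn (a i x)))"
    using assms(1) by (intro eventually_conj eventually_ball_finite) auto
  then show thesis
    using that eventually_happens'[OF trivial_limit_at_right_real] by blast
qed

definition zero_indices :: "('i \<Rightarrow> 'a \<Rightarrow> real) \<Rightarrow> 'i set \<Rightarrow> 'a \<Rightarrow> 'i set" where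
  "zero_indices a I x = {i \<in> I. a i x = 0}"

definition positive_indices :: "('i \<Rightarrow> 'a \<Rightarrow> real) \<Rightarrow> 'i set \<Rightarrow> 'a \<Rightarrow> 'i set" where
  "positive_indices a I x = {i \<in> I. 0 < a i x}"

definition common_zeros :: "('i \<Rightarrow> 'a \<Rightarrow> real) \<Rightarrow> 'i set \<Rightarrow> 'a set" where
  "common_zeros a S = {x. \<forall>i\<in>S. a i x = 0}"

text \<open>A region is recorded by the set of indices whose form is positive on it.\<close>

definition sign_regions :: "'a set \<Rightarrow> ('i \<Rightarrow> 'a \<Rightarrow> real) \<Rightarrow> 'i set \<Rightarrow> 'i set set" where
  "sign_regions V a I = positive_indices a I ` {x \<in> V. zero_indices a I x = {}}"

lemma sign_regions_empty: "V \<noteq> {} \<Longrightarrow> sign_regions V a {} = {{}}"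
  by (auto simp: sign_regions_def zero_indices_def positive_indices_def)

lemma finite_sign_regions: "finite I \<Longrightarrow> finite (sign_regions V a I)"
  by (rule finite_subset[of _ "Pow I"]) (auto simp: sign_regions_def positive_indices_def)

lemma positive_indices_in_sign_regions:
  assumes "zero_indices a I x = {}" and "y \<in> V"
    and "\<And>i. i \<in> I \<Longrightarrow> sgn (a i y) = sgn (a i x)"
  shows "positive_indices a I x \<in> sign_regions V a I"
proof -
  have "zero_indices a I y = {}"
    using assms by (auto simp: zero_indices_def) (metis sgn_0_0)
  moreover have "positive_indices a I x = positive_indices a I y"
    using assms by (auto simp: positive_indices_def) (metis sgn_greater)+
  ultimately show ?thesis
    using assms(2) by (auto simp: sign_regions_def)
qed

lemma sign_regions_insert:
  "sign_regions V a (insert k I) =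
    insert k ` sign_regions (V \<inter> {x. 0 < a k x}) a I \<union> sign_regions (V \<inter> {x. a k x < 0}) a I"
proof -
  have split: "{x \<in> V. zero_indices a (insert k I) x = {}} =
      {x \<in> V \<inter> {x. 0 < a k x}. zero_indices a I x = {}} \<union>
      {x \<in> V \<inter> {x. a k x < 0}. zero_indices a I x = {}}"
    by (auto simp: zero_indices_def)
  have "positive_indices a (insert k I) x = insert k (positive_indices a I x)"
    if "0 < a k x" for x
    using that by (auto simp: positive_indices_def)
  moreover have "positive_indices a (insert k I) x = positive_indices a I x" if "a k x < 0" for x
    using that by (auto simp: positive_indices_def)
  ultimately show ?thesis
    unfolding sign_regions_def split image_Un image_image
    by (intro arg_cong2[of _ _ _ _ "(\<union>)"] image_cong) auto
qed

lemma sign_regions_kernel_subset: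
  fixes a :: "'i \<Rightarrow> 'a::real_normed_vector \<Rightarrow> real"
  assumes "finite I" and linear: "\<And>i. i \<in> insert k I \<Longrightarrow> linear (a i)"
    and direction: "subspace V" "v \<in> V"
  shows "sign_regions (V \<inter> {x. a k x = 0}) a I
    \<subseteq> sign_regions (V \<inter> {x. sgn (a k x) = sgn (a k v)}) a I"
proof
  fix T assume "T \<in> sign_regions (V \<inter> {x. a k x = 0}) a I"
  then obtain x where in_kernel: "x \<in> V" "a k x = 0" "zero_indices a I x = {}"
      "T = positive_indices a I x"
    by (auto simp: sign_regions_def)
  obtain e where perturbed: "\<And>i. i \<in> insert k I \<Longrightarrow>
      sgn (a i (x + e *\<^sub>R v)) = (if a i x = 0 then sgn (a i v) else sgn (a i x))"
    by (rule sgn_linear_perturbation[of "insert k I" a UNIV x v]) (use assms(1) linear in auto)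
  have "x + e *\<^sub>R v \<in> V \<inter> {x. sgn (a k x) = sgn (a k v)}"
    using in_kernel direction perturbed[of k] by (simp add: subspace_add subspace_scale)
  moreover have "sgn (a i (x + e *\<^sub>R v)) = sgn (a i x)" if "i \<in> I" for i
    using perturbed[of i] in_kernel(3) that by (auto simp: zero_indices_def)
  ultimately show "T \<in> sign_regions (V \<inter> {x. sgn (a k x) = sgn (a k v)}) a I"
    unfolding in_kernel(4) using in_kernel(3)
    by (intro positive_indices_in_sign_regions[of a I x "x + e *\<^sub>R v"])
qed

text \<open>This is the convexity of regions.\<close>

lemma sign_regions_half_spaces_Int:
  fixes a :: "'i \<Rightarrow> 'a::real_vector \<Rightarrow> real"
  assumes linear: "\<And>i. i \<in> insert k I \<Longrightarrow> linear (a i)" and subspace: "subspace V"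
  shows "sign_regions (V \<inter> {x. 0 < a k x}) a I \<inter> sign_regions (V \<inter> {x. a k x < 0}) a I
    \<subseteq> sign_regions (V \<inter> {x. a k x = 0}) a I"
proof
  fix T assume "T \<in> sign_regions (V \<inter> {x. 0 < a k x}) a I \<inter> sign_regions (V \<inter> {x. a k x < 0}) a I"
  then obtain x y where
      positive: "x \<in> V" "0 < a k x" "zero_indices a I x = {}" "T = positive_indices a I x" and
      negative: "y \<in> V" "a k y < 0" "zero_indices a I y = {}" "T = positive_indices a I y"
    by (auto simp: sign_regions_def)
  define r where "r = a k x / - a k y"
  have r_pos: "0 < r"
    using positive negative by (simp add: r_def divide_pos_neg)
  have expand: "a i (x + r *\<^sub>R y) = a i x + r * a i y" if "i \<in> insert k I" for i
    using linear[OF that] by (simp add: linear_add linear_cmul)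
  have "a k (x + r *\<^sub>R y) = 0"
    using expand[of k] negative(2) by (simp add: r_def)
  then have "x + r *\<^sub>R y \<in> V \<inter> {x. a k x = 0}"
    using positive(1) negative(1) subspace by (simp add: subspace_add subspace_scale)
  moreover have "sgn (a i (x + r *\<^sub>R y)) = sgn (a i x)" if "i \<in> I" for i
  proof -
    have "a i x \<noteq> 0" "a i y \<noteq> 0" "0 < a i x \<longleftrightarrow> 0 < a i y"
      using that positive(3,4) negative(3,4) by (auto simp: zero_indices_def positive_indices_def)
    then have "sgn (a i y) = sgn (a i x)"
      by (auto simp: sgn_if)
    then have "sgn (r * a i y) = sgn (a i x)"
      using r_pos by (simp add: sgn_mult)
    then show ?thesis
      using expand[of i] that by (simp add: sgn_if split: if_splits)
  qed
  ultimately show "T \<in> sign_regions (V \<inter> {x. a k x = 0}) a I"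
    unfolding positive(4) using positive(3)
    by (intro positive_indices_in_sign_regions[of a I x "x + r *\<^sub>R y"])
qed

lemma sign_regions_half_spaces:
  fixes a :: "'i \<Rightarrow> 'a::real_normed_vector \<Rightarrow> real"
  assumes finite: "finite I" and linear: "\<And>i. i \<in> insert k I \<Longrightarrow> linear (a i)"
    and subspace: "subspace V" and nonzero: "v \<in> V" "a k v \<noteq> 0"
  defines "pos \<equiv> sign_regions (V \<inter> {x. 0 < a k x}) a I"
    and "neg \<equiv> sign_regions (V \<inter> {x. a k x < 0}) a I"
  shows "pos \<inter> neg = sign_regions (V \<inter> {x. a k x = 0}) a I" and "pos \<union> neg = sign_regions V a I"
proof -
  let ?zero = "sign_regions (V \<inter> {x. a k x = 0}) a I"
  define w where "w = sgn (a k v) *\<^sub>R v"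
  have direction: "w \<in> V" "0 < a k w" "a k (- w) < 0"
    using nonzero subspace linear[of k]
    by (auto simp: w_def subspace_scale linear_cmul linear_neg sgn_if)
  note kernel_subset = sign_regions_kernel_subset[of I k a V, OF finite linear subspace]
  have "?zero \<subseteq> pos"
    using kernel_subset[OF _ direction(1)] direction(2) by (simp add: pos_def sgn_1_pos)
  moreover have "?zero \<subseteq> neg"
    using kernel_subset[OF _ subspace_neg[OF subspace direction(1)]] direction(3)
    by (simp add: neg_def sgn_1_neg)
  ultimately show Int: "pos \<inter> neg = ?zero"
    using sign_regions_half_spaces_Int[of k I a, OF linear subspace]
    unfolding pos_def neg_def by blast
  have "{x \<in> V. zero_indices a I x = {}} =
      {x \<in> V \<inter> {x. 0 < a k x}. zero_indices a I x = {}} \<union>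
      {x \<in> V \<inter> {x. a k x < 0}. zero_indices a I x = {}} \<union>
      {x \<in> V \<inter> {x. a k x = 0}. zero_indices a I x = {}}"
    by auto
  then have "sign_regions V a I = pos \<union> neg \<union> ?zero"
    unfolding sign_regions_def pos_def neg_def by (simp add: image_Un)
  then show "pos \<union> neg = sign_regions V a I"
    using Int by blast
qed

lemma card_sign_regions_insert:
  fixes a :: "'i \<Rightarrow> 'a::real_normed_vector \<Rightarrow> real"
  assumes index: "finite I" "k \<notin> I" and linear: "\<And>i. i \<in> insert k I \<Longrightarrow> linear (a i)"
    and "subspace V" and "v \<in> V" and "a k v \<noteq> 0"
  shows "card (sign_regions V a (insert k I)) =
    card (sign_regions V a I) + card (sign_regions (V \<inter> {x. a k x = 0}) a I)"
proof -
  let ?pos = "sign_regions (V \<inter> {x. 0 < a k x}) a I"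
  let ?neg = "sign_regions (V \<inter> {x. a k x < 0}) a I"
  have k_notin: "k \<notin> T" if "T \<in> ?pos \<union> ?neg" for T
    using that index(2) by (auto simp: sign_regions_def positive_indices_def)
  have "card (sign_regions V a (insert k I)) = card (insert k ` ?pos) + card ?neg"
    unfolding sign_regions_insert using index(1) k_notin
    by (intro card_Un_disjoint) (auto simp: finite_sign_regions)
  also have "card (insert k ` ?pos) = card ?pos"
    using k_notin by (intro card_image inj_onI) (metis UnI1 insert_ident)
  also have "card ?pos + card ?neg = card (?pos \<union> ?neg) + card (?pos \<inter> ?neg)"
    using index(1) by (intro card_Un_Int finite_sign_regions)
  finally show ?thesis
    by (simp only: sign_regions_half_spaces[of I k a, OF index(1) linear assms(4-6)])
qed

lemma dim_Int_kernel:
  fixes g :: "'a::euclidean_space \<Rightarrow> real"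
  assumes linear: "linear g" and subspace: "subspace V" and nonzero: "v \<in> V" "g v \<noteq> 0"
  shows "dim V = Suc (dim (V \<inter> {x. g x = 0}))"
proof -
  have hyperplane: "{x. g x = 0} = {x. adjoint g 1 \<bullet> x = 0}"
    by (simp add: adjoint_clauses(2)[OF linear])
  have kernel: "subspace (V \<inter> {x. g x = 0})"
    using subspace linear_subspace_kernel[OF linear] by (rule subspace_inter)
  have "V \<inter> {x. g x = 0} \<noteq> {}" "\<not> V \<subseteq> {x. g x = 0}"
    using nonzero subspace_0[OF kernel] by auto
  then have "aff_dim (V \<inter> {x. g x = 0}) = aff_dim V - 1"
    unfolding hyperplane
    by (simp only: aff_dim_affine_Int_hyperplane[OF subspace_imp_affine[OF subspace]] if_False)
  then show ?thesis
    using subspace kernel by (simp add: aff_dim_subspace)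
qed

text \<open>The sum of the two dimensions has the parity of the codimension.\<close>

definition whitney_sign :: "'a::euclidean_space set \<Rightarrow> ('i \<Rightarrow> 'a \<Rightarrow> real) \<Rightarrow> 'i set \<Rightarrow> int" where
  "whitney_sign V a S = (-1) ^ (card S + dim V + dim (V \<inter> common_zeros a S))"

definition whitney_sum ::
    "'a::euclidean_space set \<Rightarrow> ('i \<Rightarrow> 'a \<Rightarrow> real) \<Rightarrow> 'i set \<Rightarrow> ('a set \<Rightarrow> int) \<Rightarrow> int" where
  "whitney_sum V a I \<phi> = (\<Sum>S\<in>Pow I. whitney_sign V a S * \<phi> (V \<inter> common_zeros a S))"

lemma whitney_sum_empty: "whitney_sum V a {} \<phi> = \<phi> V"
  by (simp add: whitney_sum_def whitney_sign_def common_zeros_def flip: mult_2)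

lemma Int_common_zeros_insert:
  "V \<inter> common_zeros a (insert k S) = (V \<inter> {x. a k x = 0}) \<inter> common_zeros a S"
  by (auto simp: common_zeros_def)

lemma whitney_sum_insert:
  assumes index: "finite I" "k \<notin> I"
    and "linear (a k)" and "subspace V" and "v \<in> V" and "a k v \<noteq> 0"
  shows "whitney_sum V a (insert k I) \<phi> =
    whitney_sum V a I \<phi> + whitney_sum (V \<inter> {x. a k x = 0}) a I \<phi>"
proof -
  have "whitney_sign V a (insert k S) = whitney_sign (V \<inter> {x. a k x = 0}) a S"
    if "S \<in> Pow I" for S
  proof -
    have "finite S" "k \<notin> S"
      using that index by (auto intro: finite_subset)
    then show ?thesis
      using dim_Int_kernel[OF assms(3-6)] by (simp add: whitney_sign_def Int_common_zeros_insert)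
  qed
  then show ?thesis
    using index by (simp add: whitney_sum_def sum_Pow_insert Int_common_zeros_insert)
qed

lemma whitney_sum_insert_degenerate:
  assumes index: "finite I" "k \<notin> I" and "\<forall>v\<in>V. a k v = 0"
  shows "whitney_sum V a (insert k I) \<phi> = 0"
proof -
  have kernel: "V \<inter> {x. a k x = 0} = V"
    using assms(3) by auto
  have "whitney_sign V a (insert k S) = - whitney_sign V a S" if "S \<in> Pow I" for S
  proof -
    have "finite S" "k \<notin> S"
      using that index by (auto intro: finite_subset)
    then show ?thesis
      by (simp add: whitney_sign_def Int_common_zeros_insert kernel)
  qed
  then show ?thesis
    using index
    by (simp add: whitney_sum_def sum_Pow_insert Int_common_zeros_insert kernel sum_negf)
qed

theorem card_sign_regions_eq_whitney_sum:
  fixes a :: "'i \<Rightarrow> 'a::euclidean_space \<Rightarrow> real"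
  assumes "finite I" and "\<And>i. i \<in> I \<Longrightarrow> linear (a i)" and "subspace V"
  shows "int (card (sign_regions V a I)) = whitney_sum V a I (\<lambda>_. 1)"
  using assms
proof (induction I arbitrary: V rule: finite_induct)
  case empty
  then have "V \<noteq> {}"
    using subspace_0 by blast
  then show ?case
    by (simp add: sign_regions_empty whitney_sum_empty)
next
  case (insert k I)
  show ?case
  proof (cases "\<forall>v\<in>V. a k v = 0")
    case True
    then have "sign_regions V a (insert k I) = {}"
      by (auto simp: sign_regions_def zero_indices_def)
    then show ?thesis
      using insert.hyps True by (simp add: whitney_sum_insert_degenerate)
  next
    case False
    then obtain v where nonzero: "v \<in> V" "a k v \<noteq> 0" by blast
    have "subspace (V \<inter> {x. a k x = 0})"
      using insert.prems by (intro subspace_inter linear_subspace_kernel) auto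
    then show ?thesis
      using card_sign_regions_insert[of I k a, OF insert.hyps insert.prems nonzero]
        insert.IH insert.prems whitney_sum_insert[of I k a V v, OF insert.hyps _ _ nonzero]
      by simp
  qed
qed

theorem whitney_sum_nonneg:
  fixes a :: "'i \<Rightarrow> 'a::euclidean_space \<Rightarrow> real"
  assumes "finite I" and "\<And>i. i \<in> I \<Longrightarrow> linear (a i)" and "subspace V" and "\<And>F. 0 \<le> \<phi> F"
  shows "0 \<le> whitney_sum V a I \<phi>"
  using assms(1-3)
proof (induction I arbitrary: V rule: finite_induct)
  case empty
  then show ?case
    using assms(4) by (simp add: whitney_sum_empty)
next
  case (insert k I)
  show ?case
  proof (cases "\<forall>v\<in>V. a k v = 0")
    case True
    then show ?thesis
      using insert.hyps by (simp add: whitney_sum_insert_degenerate)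
  next
    case False
    then obtain v where nonzero: "v \<in> V" "a k v \<noteq> 0" by blast
    have "subspace (V \<inter> {x. a k x = 0})"
      using insert.prems by (intro subspace_inter linear_subspace_kernel) auto
    then show ?thesis
      using insert.IH insert.prems
        whitney_sum_insert[of I k a V v, OF insert.hyps _ _ nonzero] by simp
  qed
qed


section \<open>The intersection poset of a central arrangement near its center\<close>

locale central_arrangement =
  fixes V :: "'a::euclidean_space set" and a :: "'i \<Rightarrow> 'a \<Rightarrow> real" and I :: "'i set"
    and p :: 'a and U :: "'a set"
  assumes subspace: "subspace V" and finite: "finite I"
    and linear: "\<And>i. i \<in> I \<Longrightarrow> linear (a i)"
    and nondegenerate: "\<And>i. i \<in> I \<Longrightarrow> \<exists>v\<in>V. a i v \<noteq> 0"
    and center: "\<And>i. i \<in> I \<Longrightarrow> a i p = 0"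
    and neighbourhood: "open U" "p \<in> U"
begin

definition slice :: "'a set" where
  "slice = {x. x - p \<in> V}"

definition region :: "'a set" where
  "region = U \<inter> slice"

definition flat :: "'i set \<Rightarrow> 'a set" where
  "flat S = slice \<inter> common_zeros a S"

abbreviation hyperplanes :: "'a set set" where
  "hyperplanes \<equiv> (\<lambda>i. flat {i}) ` I"

abbreviation poset :: "'a set set" where
  "poset \<equiv> intersection_poset region hyperplanes"

lemma form_diff_center: "i \<in> I \<Longrightarrow> a i (x - p) = a i x"
  using linear center by (simp add: linear_diff)

lemma center_in_region_Int_flat: "S \<subseteq> I \<Longrightarrow> p \<in> region \<inter> flat S"
  using neighbourhood subspace center
  by (auto simp: region_def flat_def slice_def common_zeros_def subspace_0)

text \<open>All forms vanish at the center, so moving from it towards \<open>y\<close> and then in direction \<open>v\<close>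
  composes the sign vectors of \<open>y\<close> and \<open>v\<close> without leaving the region.\<close>

lemma sign_composition_in_region:
  assumes base: "y \<in> slice" and direction: "v \<in> V"
  obtains w where "w \<in> region"
    and "\<And>i. i \<in> I \<Longrightarrow> sgn (a i w) = (if a i y = 0 then sgn (a i v) else sgn (a i y))"
proof -
  obtain d where towards_y: "p + d *\<^sub>R (y - p) \<in> U"
    "\<And>i. i \<in> I \<Longrightarrow> sgn (a i (p + d *\<^sub>R (y - p))) = sgn (a i y)"
    by (rule sgn_linear_perturbation[of I a U p "y - p"])
      (auto simp: finite linear neighbourhood center form_diff_center)
  define y' where "y' = p + d *\<^sub>R (y - p)"
  obtain e where along_v: "y' + e *\<^sub>R v \<in> U"
    "\<And>i. i \<in> I \<Longrightarrow> sgn (a i (y' + e *\<^sub>R v)) = (if a i y' = 0 then sgn (a i v) else sgn (a i y'))"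
    by (rule sgn_linear_perturbation[of I a U y' v])
      (use towards_y finite linear neighbourhood in \<open>auto simp: y'_def\<close>)
  have "y' + e *\<^sub>R v - p = d *\<^sub>R (y - p) + e *\<^sub>R v"
    by (simp add: y'_def)
  moreover have "d *\<^sub>R (y - p) + e *\<^sub>R v \<in> V"
    using base direction subspace by (simp add: slice_def subspace_add subspace_scale)
  ultimately have "y' + e *\<^sub>R v \<in> slice"
    by (simp only: slice_def mem_Collect_eq)
  moreover have "a i y' = 0 \<longleftrightarrow> a i y = 0" if "i \<in> I" for i
    using towards_y(2)[OF that] by (metis sgn_eq_0_iff y'_def)
  ultimately show thesis
    using along_v towards_y(2) by (intro that[of "y' + e *\<^sub>R v"]) (auto simp: region_def y'_def)
qed

lemma flat_Inter: "slice \<inter> \<Inter>((\<lambda>i. flat {i}) ` S) = flat S"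
  by (auto simp: flat_def common_zeros_def)

lemma region_Int_Inter: "region \<inter> \<Inter>((\<lambda>i. flat {i}) ` S) = region \<inter> flat S"
  using flat_Inter[of S] by (auto simp: region_def)

lemma region_Int_flat_subsetD:
  assumes "S \<subseteq> I" "T \<subseteq> I" and subset: "region \<inter> flat S \<subseteq> region \<inter> flat T"
  shows "flat S \<subseteq> flat T"
proof
  fix y assume in_flat: "y \<in> flat S"
  then have "y \<in> slice"
    by (simp add: flat_def)
  then obtain w where same_zeros: "w \<in> region" "\<And>i. i \<in> I \<Longrightarrow> sgn (a i w) =
      (if a i y = 0 then sgn (a i 0) else sgn (a i y))"
    using subspace_0[OF subspace] by (rule sign_composition_in_region) blast
  have zero_iff: "a i w = 0 \<longleftrightarrow> a i y = 0" if "i \<in> I" for i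
    using same_zeros(2)[OF that] linear_0[OF linear[OF that]]
    by (auto simp: sgn_zero_iff split: if_splits)
  then have flat_iff: "w \<in> flat R \<longleftrightarrow> y \<in> flat R" if "R \<subseteq> I" for R
    using that same_zeros(1) \<open>y \<in> slice\<close> by (auto simp: flat_def region_def common_zeros_def)
  show "y \<in> flat T"
    using subset same_zeros(1) in_flat flat_iff assms(1,2) by blast
qed

lemma region_Int_flat_eq_iff:
  assumes "S \<subseteq> I" "T \<subseteq> I"
  shows "region \<inter> flat S = region \<inter> flat T \<longleftrightarrow> flat S = flat T"
  using region_Int_flat_subsetD[of S T] region_Int_flat_subsetD[of T S] assms by blast

lemma flat_eq_iff:
  assumes "S \<subseteq> I" "T \<subseteq> I"
  shows "flat S = flat T \<longleftrightarrow> V \<inter> common_zeros a S = V \<inter> common_zeros a T"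
proof -
  have "flat R = (\<lambda>x. x - p) -` (V \<inter> common_zeros a R)" if "R \<subseteq> I" for R
    using subsetD[OF that] form_diff_center
    by (simp add: flat_def slice_def common_zeros_def set_eq_iff)
  moreover have "surj (\<lambda>x. x - p)"
    by (rule surjI[of _ "\<lambda>x. x + p"]) simp
  ultimately show ?thesis
    using assms surj_image_vimage_eq by metis
qed

lemma poset_eq: "poset = (\<lambda>S. region \<inter> flat S) ` Pow I"
proof -
  have "poset = (\<lambda>S. region \<inter> flat S) ` Pow I - {{}}"
    by (simp add: intersection_poset_image region_Int_Inter)
  moreover have "{} \<notin> (\<lambda>S. region \<inter> flat S) ` Pow I"
    using center_in_region_Int_flat by blast
  ultimately show ?thesis
    by simp
qed

lemma not_region_subset_hyperplane:
  assumes "i \<in> I"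
  shows "\<not> region \<subseteq> flat {i}"
proof -
  obtain v where nonzero: "v \<in> V" "a i v \<noteq> 0"
    using nondegenerate assms by blast
  have "p \<in> slice"
    using center_in_region_Int_flat[of "{}"] by (simp add: region_def)
  then obtain w where "w \<in> region" "sgn (a i w) = sgn (a i v)"
    using nonzero(1) by (rule sign_composition_in_region) (use assms center in auto)
  then have "a i w \<noteq> 0"
    using nonzero(2) by (metis sgn_eq_0_iff)
  then show ?thesis
    using \<open>w \<in> region\<close> by (auto simp: flat_def common_zeros_def)
qed

lemma mobius_poset:
  assumes "u \<in> poset"
  shows "mobius poset region u = (\<Sum>S | S \<subseteq> I \<and> region \<inter> flat S = u. (-1) ^ card S)"
  using mobius_intersection_poset[OF finite not_region_subset_hyperplane assms]
  by (simp add: region_Int_Inter)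

text \<open>The signs by which \<open>whitney_sign\<close> differs from \<open>(-1) ^ card S\<close> agree for all \<open>S\<close> cutting out
  the same flat.\<close>

lemma abs_mobius_poset:
  assumes "u \<in> poset"
  shows "\<bar>mobius poset region u\<bar> = (\<Sum>S | S \<subseteq> I \<and> region \<inter> flat S = u. whitney_sign V a S)"
proof -
  obtain T where cut_out_u: "T \<subseteq> I" "u = region \<inter> flat T"
    using assms poset_eq by blast
  define F where "F = V \<inter> common_zeros a T"
  let ?\<S> = "{S. S \<subseteq> I \<and> region \<inter> flat S = u}"
  have "region \<inter> flat S = u \<longleftrightarrow> V \<inter> common_zeros a S = F" if "S \<subseteq> I" for S
    unfolding cut_out_u(2) F_def
    using region_Int_flat_eq_iff[OF that cut_out_u(1)] flat_eq_iff[OF that cut_out_u(1)] by simp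
  then have cut_out: "?\<S> = {S \<in> Pow I. V \<inter> common_zeros a S = F}"
    by auto
  have "whitney_sum V a I (\<lambda>G. of_bool (G = F)) = sum (whitney_sign V a) ?\<S>"
    unfolding whitney_sum_def cut_out using finite
    by (simp add: Pow_def Collect_conj_eq)
  moreover have "0 \<le> whitney_sum V a I (\<lambda>G. of_bool (G = F))"
    by (intro whitney_sum_nonneg) (simp_all add: finite linear subspace)
  ultimately have nonneg: "0 \<le> sum (whitney_sign V a) ?\<S>"
    by simp
  have "sum (whitney_sign V a) ?\<S> = (-1) ^ (dim V + dim F) * mobius poset region u"
    unfolding mobius_poset[OF assms] sum_distrib_left cut_out
    by (intro sum.cong refl) (auto simp: whitney_sign_def power_add)
  then have "\<bar>sum (whitney_sign V a) ?\<S>\<bar> = \<bar>mobius poset region u\<bar>"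
    by (simp add: abs_mult power_abs)
  with nonneg show ?thesis
    by simp
qed

lemma sum_poset_count:
  assumes finite_X: "finite X"
    and count: "\<And>S. S \<subseteq> I \<Longrightarrow> N (region \<inter> flat S) = card {x \<in> X. S \<subseteq> zero_indices a I x}"
    and weight: "\<And>u. u \<in> poset \<Longrightarrow> \<phi> u = (\<Sum>S | S \<subseteq> I \<and> region \<inter> flat S = u. c S)"
  shows "(\<Sum>u\<in>poset. \<phi> u * int (N u)) = (\<Sum>x\<in>X. \<Sum>S\<in>Pow (zero_indices a I x). c S)"
proof -
  have "(\<Sum>u\<in>poset. \<phi> u * int (N u)) = (\<Sum>u\<in>poset. \<Sum>S | S \<in> Pow I \<and> region \<inter> flat S = u.
      c S * int (N (region \<inter> flat S)))"
    by (intro sum.cong refl) (simp add: weight sum_distrib_right)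
  also have "\<dots> = (\<Sum>S\<in>Pow I. c S * int (N (region \<inter> flat S)))"
    unfolding poset_eq using finite by (intro sum.group) auto
  also have "\<dots> = (\<Sum>S\<in>Pow I. \<Sum>x | x \<in> X \<and> S \<subseteq> zero_indices a I x. c S)"
    by (simp add: count mult.commute)
  also have "\<dots> = (\<Sum>x\<in>X. \<Sum>S | S \<in> Pow I \<and> S \<subseteq> zero_indices a I x. c S)"
    using finite_X finite by (intro sum.swap_restrict) auto
  also have "\<dots> = (\<Sum>x\<in>X. \<Sum>S\<in>Pow (zero_indices a I x). c S)"
    by (intro sum.cong refl arg_cong2[of _ _ _ _ sum]) (auto simp: zero_indices_def)
  finally show ?thesis .
qed

theorem sum_mobius_count:
  assumes finite_X: "finite X"
    and count: "\<And>S. S \<subseteq> I \<Longrightarrow> N (region \<inter> flat S) = card {x \<in> X. S \<subseteq> zero_indices a I x}"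
  shows "(\<Sum>u\<in>poset. mobius poset region u * int (N u)) =
    int (card {x \<in> X. zero_indices a I x = {}})"
proof -
  have "finite (zero_indices a I x)" for x
    using finite by (simp add: zero_indices_def)
  then have "(\<Sum>x\<in>X. \<Sum>S\<in>Pow (zero_indices a I x). (-1) ^ card S) =
      (\<Sum>x\<in>X. if zero_indices a I x = {} then 1 else 0 :: int)"
    by (simp add: sum_Pow_minus_one_power_card)
  also have "\<dots> = int (card {x \<in> X. zero_indices a I x = {}})"
    using finite_X by (simp flip: sum.inter_filter)
  finally show ?thesis
    using sum_poset_count[OF finite_X count mobius_poset] by simp
qed

theorem sum_abs_mobius_count:
  assumes finite_X: "finite X"
    and count: "\<And>S. S \<subseteq> I \<Longrightarrow> N (region \<inter> flat S) = card {x \<in> X. S \<subseteq> zero_indices a I x}"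
  shows "(\<Sum>u\<in>poset. \<bar>mobius poset region u\<bar> * int (N u)) =
    (\<Sum>x\<in>X. int (card (sign_regions V a (zero_indices a I x))))"
proof -
  have "int (card (sign_regions V a (zero_indices a I x))) =
      (\<Sum>S\<in>Pow (zero_indices a I x). whitney_sign V a S)" for x
    using card_sign_regions_eq_whitney_sum[of "zero_indices a I x" a V] finite linear subspace
    by (simp add: zero_indices_def whitney_sum_def)
  then show ?thesis
    using sum_poset_count[OF finite_X count abs_mobius_poset] by simp
qed

end


section \<open>Orderings of the coordinates\<close>

lemma ex_strict_mono_onto:
  fixes B :: "'b::linorder set"
  assumes "finite B" and "card B = CARD('a::{finite,linorder})"
  obtains h :: "'a::{finite,linorder} \<Rightarrow> 'b" where "strict_mono h" and "range h = B"
proof -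
  define h where "h x = sorted_list_of_set B ! card {..<x}" for x :: 'a
  have bound: "card {..<x} < length (sorted_list_of_set B)" for x :: 'a
    using assms by (auto intro!: psubset_card_mono)
  have mono: "strict_mono h"
  proof (rule strict_monoI)
    fix x y :: 'a assume "x < y"
    then have "card {..<x} < card {..<y}"
      by (intro psubset_card_mono) auto
    then show "h x < h y"
      unfolding h_def by (intro sorted_wrt_nth_less[of "(<)"] bound) simp_all
  qed
  have "range h \<subseteq> B"
    using nth_mem[OF bound] assms(1) by (auto simp: h_def)
  moreover have "card (range h) = card B"
    using strict_mono_imp_inj_on[OF mono] assms(2) by (simp add: card_image)
  ultimately have "range h = B"
    using assms(1) by (intro card_subset_eq)
  with mono show thesis
    by (rule that)
qed

lemma strict_mono_finite_eq_id:
  fixes h :: "'a::{finite,linorder} \<Rightarrow> 'a"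
  assumes "strict_mono h"
  shows "h = id"
proof -
  let ?xs = "sorted_list_of_set (UNIV :: 'a set)"
  have "sorted_wrt (<) (map h ?xs)"
    unfolding sorted_wrt_map
    by (rule sorted_wrt_mono_rel[of _ "(<)"]) (simp_all add: strict_monoD[OF assms])
  moreover have "set (map h ?xs) = set ?xs"
    using finite_UNIV_inj_surj[OF finite strict_mono_imp_inj_on[OF assms]] by simp
  ultimately have "map h ?xs = map id ?xs"
    by (simp add: strict_sorted_equal)
  then have "\<forall>x\<in>set ?xs. h x = id x"
    by (simp only: map_eq_conv)
  then show ?thesis
    by auto
qed

lemma realizing_permutation_exists:
  fixes y :: "real^'n::{finite,linorder}"
  assumes "distinct_entries y"
  obtains \<sigma> where "\<sigma> permutes UNIV" and "realizes y \<sigma>"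
proof -
  have "card (range (($) y)) = CARD('n)"
    using assms by (simp add: distinct_entries_def card_image)
  then obtain h :: "'n \<Rightarrow> real" where sorting: "strict_mono h" "range h = range (($) y)"
    using ex_strict_mono_onto[of "range (($) y)"] by auto
  define \<sigma> where "\<sigma> = inv (($) y) \<circ> h"
  have y_\<sigma>: "y $ \<sigma> i = h i" for i
    unfolding \<sigma>_def comp_def using sorting(2) by (intro f_inv_into_f) auto
  then have "inj \<sigma>"
    using strict_mono_imp_inj_on[OF sorting(1)] by (metis injD injI)
  then have "\<sigma> permutes UNIV"
    using finite_UNIV_inj_surj by (auto intro!: bij_imp_permutes bijI)
  moreover have "realizes y \<sigma>"
    using sorting(1) by (simp add: realizes_def y_\<sigma>)
  ultimately show thesis
    by (rule that)
qed

lemma realizes_less_iff: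
  assumes "\<sigma> permutes UNIV" and "realizes y \<sigma>"
  shows "y $ j < y $ k \<longleftrightarrow> inv \<sigma> j < inv \<sigma> k"
  using strict_mono_less[OF assms(2)[unfolded realizes_def], of "inv \<sigma> j" "inv \<sigma> k"]
  by (simp add: permutes_inverses[OF assms(1)])

lemma compatible_iff:
  assumes permutes: "\<sigma> permutes UNIV"
  shows "compatible y \<sigma> \<longleftrightarrow> (\<forall>j k. y $ j < y $ k \<longrightarrow> inv \<sigma> j < inv \<sigma> k)"
proof
  assume "compatible y \<sigma>"
  then have "y $ k \<le> y $ j" if "inv \<sigma> k \<le> inv \<sigma> j" for j k
    using monoD[of _ "inv \<sigma> k" "inv \<sigma> j"] that
    by (fastforce simp: compatible_def permutes_inverses[OF permutes])
  then show "\<forall>j k. y $ j < y $ k \<longrightarrow> inv \<sigma> j < inv \<sigma> k"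
    by (meson not_less)
next
  assume inv_less: "\<forall>j k. y $ j < y $ k \<longrightarrow> inv \<sigma> j < inv \<sigma> k"
  show "compatible y \<sigma>"
    unfolding compatible_def
  proof (rule monoI)
    fix i i' :: 'a assume "i \<le> i'"
    then show "y $ \<sigma> i \<le> y $ \<sigma> i'"
      using inv_less by (metis not_less permutes_inverses(2)[OF permutes])
  qed
qed

definition off_diagonal :: "('n \<times> 'n) set" where
  "off_diagonal = {(j, k). j \<noteq> k}"

definition coord_diff :: "'n \<times> 'n \<Rightarrow> real^'n \<Rightarrow> real" where
  "coord_diff i x = x $ fst i - x $ snd i"

abbreviation ties :: "real^'n \<Rightarrow> ('n \<times> 'n) set" where
  "ties \<equiv> zero_indices coord_diff off_diagonal"

definition inversions :: "('n \<times> 'n) set \<Rightarrow> ('n::linorder \<Rightarrow> 'n) \<Rightarrow> ('n \<times> 'n) set" where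
  "inversions S \<sigma> = {(j, k) \<in> S. inv \<sigma> k < inv \<sigma> j}"

lemma linear_coord_diff: "linear (coord_diff i)"
  by (rule linearI) (simp_all add: coord_diff_def algebra_simps)

lemma ties_empty_iff: "ties x = {} \<longleftrightarrow> distinct_entries x"
  by (auto simp: zero_indices_def off_diagonal_def coord_diff_def distinct_entries_def inj_def)

lemma ties_scaleR: "r \<noteq> 0 \<Longrightarrow> ties (r *\<^sub>R x) = ties x"
  by (simp add: zero_indices_def linear_cmul[OF linear_coord_diff])

lemma positive_indices_realizes:
  assumes "\<sigma> permutes UNIV" and "realizes w \<sigma>"
  shows "positive_indices coord_diff S w = inversions S \<sigma>"
  by (auto simp: positive_indices_def inversions_def coord_diff_def realizes_less_iff[OF assms])

lemma inj_on_inversions_ties: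
  "inj_on (inversions (ties y)) {\<sigma>. \<sigma> permutes UNIV \<and> compatible y \<sigma>}"
proof (rule inj_onI, clarify)
  fix \<sigma> \<tau> :: "'a \<Rightarrow> 'a"
  assume \<sigma>: "\<sigma> permutes UNIV" "compatible y \<sigma>" and \<tau>: "\<tau> permutes UNIV" "compatible y \<tau>"
    and eq: "inversions (ties y) \<sigma> = inversions (ties y) \<tau>"
  have same_order: "inv \<sigma> j < inv \<sigma> k" if less: "inv \<tau> j < inv \<tau> k" for j k
  proof -
    consider (below) "y $ j < y $ k" | (above) "y $ k < y $ j" | (tied) "y $ j = y $ k"
      by linarith
    then show ?thesis
    proof cases
      case tied
      then have "(k, j) \<in> ties y"
        using less by (auto simp: zero_indices_def off_diagonal_def coord_diff_def)
      then show ?thesis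
        using eq less by (auto simp: inversions_def)
    qed (use \<sigma> \<tau> less in \<open>auto simp: compatible_iff dest: less_asym\<close>)
  qed
  have "strict_mono (inv \<sigma> \<circ> \<tau>)"
    by (rule strict_monoI) (simp add: same_order permutes_inverses[OF \<tau>(1)])
  then have "inv \<sigma> (\<tau> i) = i" for i
    using strict_mono_finite_eq_id by (metis comp_apply id_apply)
  then show "\<sigma> = \<tau>"
    using permutes_inverses(1)[OF \<sigma>(1)] by (metis ext)
qed

definition compatible_orderings ::
    "(real^'n::{finite,linorder}) set \<Rightarrow> real^'n::{finite,linorder} \<Rightarrow>
      ('n::{finite,linorder} \<Rightarrow> 'n) set" where
  "compatible_orderings R x = {\<sigma>. \<sigma> permutes UNIV \<and> compatible x \<sigma> \<and> realizable_in R \<sigma>}"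


section \<open>Slices of the braid arrangement through a point of the diagonal\<close>

lemma open_open_orthant: "open (open_orthant :: (real^'n) set)"
  using open_vector_box[of "\<lambda>_ :: 'n. {0 :: real<..}"] by (simp add: open_orthant_def)

lemma interior_orthant: "interior (orthant :: (real^'n) set) = open_orthant"
proof (rule interior_unique)
  fix T :: "(real^'n) set" assume open_subset: "T \<subseteq> orthant" "open T"
  have "T \<subseteq> interior {x. 0 \<le> x $ j}" for j
    using open_subset by (intro interior_maximal) (auto simp: orthant_def)
  then show "T \<subseteq> open_orthant"
    by (auto simp: open_orthant_def)
qed (use open_open_orthant in \<open>auto simp: open_orthant_def orthant_def less_imp_le\<close>)

lemma convex_orthant: "convex (orthant :: (real^'n) set)"
  by (auto simp: convex_def orthant_def)

locale braid_slice =
  fixes V :: "(real^'n::{finite,linorder}) set" and q :: real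
  assumes subspace_V: "subspace V" and q_pos: "0 < q"
    and separated: "\<And>j k. j \<noteq> k \<Longrightarrow> \<exists>v\<in>V. v $ j \<noteq> v $ k"

sublocale braid_slice \<subseteq> central_arrangement V coord_diff off_diagonal "\<chi> j. q" open_orthant
proof (rule central_arrangement.intro)
  show "(\<chi> j. q) \<in> open_orthant"
    using q_pos by (simp add: open_orthant_def)
qed (use subspace_V separated in
  \<open>auto simp: linear_coord_diff open_open_orthant off_diagonal_def coord_diff_def\<close>)

context braid_slice
begin

lemma rel_interior_orthant_Int_slice: "rel_interior (orthant \<inter> slice) = region"
proof -
  have center: "(\<chi> j. q) \<in> open_orthant" "(\<chi> j. q) \<in> slice"
    using q_pos subspace_0[OF subspace_V] by (auto simp: open_orthant_def slice_def)
  have "slice = (+) (\<chi> j. q) ` V"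
    unfolding slice_def by (force simp: image_iff algebra_simps)
  then have "affine slice"
    using subspace_imp_affine[OF subspace_V] by (metis affine_translation)
  moreover have "rel_interior orthant = (open_orthant :: ((real, 'n) vec) set)"
    using center(1) by (metis empty_iff interior_orthant rel_interior_nonempty_interior)
  ultimately show ?thesis
    unfolding region_def using center convex_orthant convex_affine_rel_interior_Int by blast
qed

lemma induced_arrangement_slice: "induced_arrangement slice = hyperplanes"
proof -
  have flat: "hyperplane_eq j k \<inter> slice = flat {(j, k)}" for j k
    by (auto simp: hyperplane_eq_def flat_def common_zeros_def coord_diff_def)
  have "\<not> slice \<subseteq> hyperplane_eq j k" if "j \<noteq> k" for j k
    using not_region_subset_hyperplane[of "(j, k)"] that
    by (auto simp: off_diagonal_def region_def simp flip: flat)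
  then have "induced_arrangement slice = {flat {(j, k)} |j k. j \<noteq> k}"
    unfolding induced_arrangement_def flat by blast
  then show ?thesis
    by (auto simp: off_diagonal_def)
qed

lemma flat_of_region_Int_flat:
  assumes "S \<subseteq> off_diagonal"
  shows "flat_of slice region hyperplanes (region \<inter> flat S) = flat S"
  unfolding flat_of_def
proof (rule the_equality)
  show "\<exists>\<S>\<subseteq>hyperplanes. flat S = slice \<inter> \<Inter>\<S> \<and> region \<inter> flat S = region \<inter> flat S"
    using assms flat_Inter by (intro exI[of _ "(\<lambda>i. flat {i}) ` S"]) auto
next
  fix F assume "\<exists>\<S>\<subseteq>hyperplanes. F = slice \<inter> \<Inter>\<S> \<and> region \<inter> F = region \<inter> flat S"
  then obtain T where "T \<subseteq> off_diagonal" "F = flat T" "region \<inter> F = region \<inter> flat S"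
    unfolding subset_image_iff using flat_Inter by auto
  then show "F = flat S"
    using region_Int_flat_eq_iff assms by blast
qed

lemma ehrhart_flat_of:
  assumes "S \<subseteq> off_diagonal" and "1 \<le> t"
  shows "ehrhart (Q \<inter> flat_of slice region hyperplanes (region \<inter> flat S)) t =
    card {x \<in> integer_points (dilate t (Q \<inter> slice)). S \<subseteq> ties x}"
proof -
  have "flat S = {x \<in> slice. S \<subseteq> ties x}"
    using assms(1) by (auto simp: flat_def common_zeros_def zero_indices_def)
  then have "dilate t (Q \<inter> flat S) = {x \<in> dilate t (Q \<inter> slice). S \<subseteq> ties x}"
    using assms(2) by (auto simp: dilate_def ties_scaleR)
  then show ?thesis
    unfolding ehrhart_def integer_points_def flat_of_region_Int_flat[OF assms(1)]
    by (intro arg_cong[of _ _ card]) auto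
qed

lemma inversions_in_sign_regions:
  assumes "\<sigma> \<in> compatible_orderings region y"
  shows "inversions (ties y) \<sigma> \<in> sign_regions V coord_diff (ties y)"
proof -
  obtain w where realizing: "w \<in> region" "realizes w \<sigma>" and permutes: "\<sigma> permutes UNIV"
    using assms by (auto simp: compatible_orderings_def realizable_in_def)
  have "inj (($) w \<circ> \<sigma>)"
    using strict_mono_imp_inj_on realizing(2) by (simp add: realizes_def comp_def)
  then have "ties w = {}"
    unfolding ties_empty_iff distinct_entries_def
    using inj_on_imageI[of "($) w" \<sigma> UNIV] permutes_surj[OF permutes] by simp
  then have "zero_indices coord_diff (ties y) w = {}"
    by (auto simp: zero_indices_def)
  then have "positive_indices coord_diff (ties y) w \<in> sign_regions V coord_diff (ties y)"
    using realizing(1) form_diff_center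
    by (intro positive_indices_in_sign_regions[of _ _ w "w - (\<chi> j. q)"])
      (auto simp: region_def slice_def zero_indices_def)
  then show ?thesis
    by (simp add: positive_indices_realizes[OF permutes realizing(2)])
qed

text \<open>Moving from \<open>y\<close> into a region of the arrangement localized at \<open>y\<close> resolves the ties of \<open>y\<close>
  and keeps all strict inequalities.\<close>

lemma sign_regions_subset_inversions:
  assumes in_slice: "y \<in> slice"
  shows "sign_regions V coord_diff (ties y) \<subseteq> inversions (ties y) ` compatible_orderings region y"
proof
  fix T assume "T \<in> sign_regions V coord_diff (ties y)"
  then obtain v where resolving: "v \<in> V" "zero_indices coord_diff (ties y) v = {}"
      and T_eq: "T = positive_indices coord_diff (ties y) v"
    by (auto simp: sign_regions_def)
  obtain w where in_region: "w \<in> region" and sgn_w: "\<And>i. i \<in> off_diagonal \<Longrightarrow>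
      sgn (coord_diff i w) =
        (if coord_diff i y = 0 then sgn (coord_diff i v) else sgn (coord_diff i y))"
    using in_slice resolving(1) by (rule sign_composition_in_region) blast
  have "coord_diff i w \<noteq> 0" if "i \<in> off_diagonal" for i
    using sgn_w[OF that] resolving(2) that
    by (cases i) (auto simp: zero_indices_def sgn_zero_iff split: if_splits)
  then have "distinct_entries w"
    by (auto simp: zero_indices_def simp flip: ties_empty_iff)
  then obtain \<sigma> where realizing: "\<sigma> permutes UNIV" "realizes w \<sigma>"
    by (rule realizing_permutation_exists)
  have "inv \<sigma> j < inv \<sigma> k" if "y $ j < y $ k" for j k
  proof -
    have "sgn (coord_diff (j, k) w) = -1"
      using sgn_w[of "(j, k)"] that by (auto simp: off_diagonal_def coord_diff_def)
    then show ?thesis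
      using realizes_less_iff[OF realizing] by (simp add: coord_diff_def sgn_1_neg)
  qed
  then have "\<sigma> \<in> compatible_orderings region y"
    using realizing in_region
    by (auto simp: compatible_orderings_def compatible_iff realizable_in_def)
  moreover have "sgn (coord_diff i w) = sgn (coord_diff i v)" if "i \<in> ties y" for i
    using sgn_w[of i] that by (auto simp: zero_indices_def)
  then have "T = positive_indices coord_diff (ties y) w"
    unfolding T_eq positive_indices_def by (intro Collect_cong conj_cong refl) (metis sgn_greater)
  ultimately show "T \<in> inversions (ties y) ` compatible_orderings region y"
    by (simp add: positive_indices_realizes[OF realizing])
qed

lemma card_compatible_orderings:
  assumes "y \<in> slice"
  shows "card (compatible_orderings region y) = card (sign_regions V coord_diff (ties y))"
proof -
  have "inversions (ties y) ` compatible_orderings region y = sign_regions V coord_diff (ties y)"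
    using inversions_in_sign_regions sign_regions_subset_inversions[OF assms] by blast
  moreover have "inj_on (inversions (ties y)) (compatible_orderings region y)"
    by (rule inj_on_subset[OF inj_on_inversions_ties]) (auto simp: compatible_orderings_def)
  ultimately show ?thesis
    by (metis card_image)
qed

lemma card_compatible_orderings_dilate:
  assumes "x \<in> dilate t (Q \<inter> slice)" and "1 \<le> t"
  shows "card (compatible_orderings region x) = card (sign_regions V coord_diff (ties x))"
proof -
  obtain y where scaled: "y \<in> slice" "x = real t *\<^sub>R y"
    using assms(1) by (auto simp: dilate_def)
  have "compatible_orderings region x = compatible_orderings region y"
    using assms(2) by (simp add: scaled(2) compatible_orderings_def compatible_def mono_def)
  then show ?thesis
    using card_compatible_orderings[OF scaled(1)] assms(2) by (simp add: scaled(2) ties_scaleR)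
qed

theorem sum_mobius_ehrhart:
  assumes "1 \<le> t" and "finite (integer_points (dilate t (Q \<inter> slice)))"
  shows "(\<Sum>u\<in>poset. mobius poset region u *
      int (ehrhart (Q \<inter> flat_of slice region hyperplanes u) t)) =
    int (card {x \<in> integer_points (dilate t (Q \<inter> slice)). distinct_entries x})"
  using sum_mobius_count[OF assms(2) ehrhart_flat_of[OF _ assms(1)]]
  by (simp only: ties_empty_iff)

theorem sum_abs_mobius_ehrhart:
  assumes "1 \<le> t" and "finite (integer_points (dilate t (Q \<inter> slice)))"
  shows "(\<Sum>u\<in>poset. \<bar>mobius poset region u\<bar> *
      int (ehrhart (Q \<inter> flat_of slice region hyperplanes u) t)) =
    int (card (SIGMA x:integer_points (dilate t (Q \<inter> slice)). compatible_orderings region x))"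
proof -
  have "card (sign_regions V coord_diff (ties x)) = card (compatible_orderings region x)"
    if "x \<in> integer_points (dilate t (Q \<inter> slice))" for x
    using that card_compatible_orderings_dilate[OF _ assms(1)] by (auto simp: integer_points_def)
  then show ?thesis
    using sum_abs_mobius_count[OF assms(2) ehrhart_flat_of[OF _ assms(1)]] assms(2) by simp
qed

end


section \<open>Magic labellings\<close>

definition homogeneous_solutions :: "nat \<Rightarrow> (nat \<Rightarrow> real^'n \<Rightarrow> real) \<Rightarrow> (real^'n) set" where
  "homogeneous_solutions m f = {v. \<forall>i\<in>{1..m}. f i v = 0}"

lemma subspace_homogeneous_solutions:
  assumes "\<And>i. i \<in> {1..m} \<Longrightarrow> linear (f i)"
  shows "subspace (homogeneous_solutions m f)"
  using assms
  by (auto simp: homogeneous_solutions_def subspace_def linear_0 linear_add linear_cmul)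

lemma linear_constant_vector:
  fixes g :: "real^'n \<Rightarrow> real"
  assumes "linear g"
  shows "g (\<chi> j. r) = r * g (\<chi> j. 1)"
proof -
  have "(\<chi> j. r) = r *\<^sub>R ((\<chi> j. 1) :: real^'n)"
    by (simp add: vec_eq_iff)
  then show ?thesis
    using assms by (simp add: linear_cmul)
qed

lemma solution_space_eq:
  fixes f :: "nat \<Rightarrow> real^'n \<Rightarrow> real"
  assumes "\<And>i. i \<in> {1..m} \<Longrightarrow> linear (f i)" and "\<And>i. i \<in> {1..m} \<Longrightarrow> f i (\<chi> j. 1) = c" and "c \<noteq> 0"
  shows "solution_space m f = {x. x - (\<chi> j. 1 / c) \<in> homogeneous_solutions m f}"
proof -
  have "f i (x - (\<chi> j. 1 / c)) = f i x - 1" if "i \<in> {1..m}" for i x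
    using assms(1,2)[OF that] assms(3) linear_constant_vector[of "f i" "1 / c"]
    by (simp add: linear_diff)
  then show ?thesis
    by (simp add: solution_space_def homogeneous_solutions_def)
qed

lemma braid_slice_homogeneous_solutions:
  fixes f :: "nat \<Rightarrow> real^'n::{finite,linorder} \<Rightarrow> real"
  assumes linear: "\<And>i. i \<in> {1..m} \<Longrightarrow> linear (f i)"
    and weight: "\<And>i. i \<in> {1..m} \<Longrightarrow> f i (\<chi> j. 1) = c" "0 < c"
    and magic: "magic_labelling m f x"
  shows "braid_slice (homogeneous_solutions m f) (1 / c)"
proof
  show "subspace (homogeneous_solutions m f)"
    using linear by (rule subspace_homogeneous_solutions)
  show "0 < 1 / c"
    using weight(2) by simp
  define z where "z = x - (\<chi> j. f 1 x / c)"
  have "f i z = 0" if index: "i \<in> {1..m}" for i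
  proof -
    have "1 \<in> {1..m}"
      using index by auto
    then have "f i x = f 1 x"
      using magic index unfolding magic_labelling_def by blast
    then show ?thesis
      using linear[OF index] weight(1)[OF index] weight(2)
        linear_constant_vector[of "f i" "f 1 x / c"]
      by (simp add: z_def linear_diff)
  qed
  then have "z \<in> homogeneous_solutions m f"
    by (simp add: homogeneous_solutions_def)
  moreover have "z $ j \<noteq> z $ k" if "j \<noteq> k" for j k
    using magic that by (simp add: magic_labelling_def distinct_entries_def z_def inj_eq)
  ultimately show "\<exists>v\<in>homogeneous_solutions m f. v $ j \<noteq> v $ k" if "j \<noteq> k" for j k
    using that by blast
qed

lemma strict_magic_count_eq:
  assumes "1 \<le> t"
  shows "strict_magic_count m f t =
    card {x \<in> integer_points (dilate t (open_orthant \<inter> solution_space m f)). distinct_entries x}"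
  unfolding strict_magic_count_def using assms
  by (intro arg_cong[of _ _ card])
    (auto simp: magic_polytope_def integer_points_def dilate_def orthant_def open_orthant_def
      less_imp_le zero_less_mult_iff)

lemma weak_magic_count_eq:
  "weak_magic_count m f t = card (SIGMA x:integer_points (dilate t (magic_polytope m f)).
    compatible_orderings (rel_interior (magic_polytope m f)) x)"
  unfolding weak_magic_count_def
  by (intro arg_cong[of _ _ card])
    (auto simp: compatible_orderings_def magic_polytope_def integer_points_def dilate_def
      orthant_def)

theorem theorem3p17:
  fixes f :: "nat \<Rightarrow> real^'n::{finite,linorder} \<Rightarrow> real"
    and m t :: nat
  assumes forms: "\<forall>i\<in>{1..m}. rational_linear_form (f i)"
    and weight: "\<exists>c>0. \<forall>i\<in>{1..m}. f i (\<chi> j. 1) = c"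
    and cover: "\<forall>j. \<exists>i\<in>{1..m}. appears_in j (f i)"
    and consistent: "solution_space m f \<noteq> {}"
    and magic: "\<exists>x. magic_labelling m f x"
    and t: "1 \<le> t"
  shows
    "let s = solution_space m f;
         P\<^sub>0 = rel_interior (magic_polytope m f);
         \<H> = induced_arrangement s;
         L = intersection_poset P\<^sub>0 \<H>
     in (finite (integer_points (dilate t (open_orthant \<inter> s))) \<longrightarrow>
           int (strict_magic_count m f t) =
             (\<Sum>u\<in>L. mobius L P\<^sub>0 u * int (ehrhart (open_orthant \<inter> flat_of s P\<^sub>0 \<H> u) t))) \<and>
        (finite (integer_points (dilate t (magic_polytope m f))) \<longrightarrow>
           int (weak_magic_count m f t) =
             (\<Sum>u\<in>L. \<bar>mobius L P\<^sub>0 u\<bar> * int (ehrhart (orthant \<inter> flat_of s P\<^sub>0 \<H> u) t)))"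
proof -
  obtain c where weight_c: "0 < c" "\<And>i. i \<in> {1..m} \<Longrightarrow> f i (\<chi> j. 1) = c"
    using weight by blast
  obtain x where labelling: "magic_labelling m f x"
    using magic by blast
  have linear_f: "linear (f i)" if "i \<in> {1..m}" for i
    using forms that by (simp add: rational_linear_form_def)
  interpret braid_slice "homogeneous_solutions m f" "1 / c"
    using linear_f weight_c(2,1) labelling by (rule braid_slice_homogeneous_solutions)
  have s: "solution_space m f = slice"
    using solution_space_eq[OF linear_f weight_c(2)] weight_c(1) by (simp add: slice_def)
  have polytope: "magic_polytope m f = orthant \<inter> slice"
    by (auto simp: magic_polytope_def s)
  show ?thesis
    unfolding Let_def strict_magic_count_eq[OF t] weak_magic_count_eq s polytope
      rel_interior_orthant_Int_slice induced_arrangement_slice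
    using sum_mobius_ehrhart[OF t] sum_abs_mobius_ehrhart[OF t] by simp
qed

end
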